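(* Let $\varphi: T\to T$ be a nonconstant Lipschitz function such that $C_\varphi$ is bounded on $\mathcal{L}_0$. Then the point spectrum $\sigma_{\mathrm p}(C_\varphi)$ of $C_\varphi$ as an operator on $\mathcal{L}_0$ is contained in the closed disk in $\mathbb{C}$ centered at $0$ of radius $\lambda_\varphi$.
   Context: $T$ is an infinite, locally finite tree (connected graph without cycles, identified with its vertex set) with a chosen root $o$, in which every vertex except possibly $o$ has degree greater than $1$. $d(v,w)$ is the number of edges of the unique path joining $v$ and $w$, and $|v|=d(o,v)$. $T^*=T\setminus\{o\}$. For $v\in T^*$, the parent $v^-$ is the neighbor of $v$ on the path from $o$ to $v$. The Lipschitz space $\mathcal{L}$ is the set of $f:T\to\mathbb{C}$ with $\sup_{v\in T^*}|f(v)-f(v^-)|<\infty$, a Banach space under $\|f\|_{\mathcal{L}}=\max\{|f(o)|,\sup_{v\in T^*}|f(v)-f(v^-)|\}$. The little Lipschitz space $\mathcal{L}_0$ is the closed subspace of $f\in\mathcal{L}$ with $\lim_{|v|\to\infty}|f(v)-f(v^-)|=0$. A map $\varphi:T\to T$ is Lipschitz if its Lipschitz number $\lambda_\varphi=\sup_{v\ne w} d(\varphi(v),\varphi(w))/d(v,w)$ is finite. The composition operator is $C_\varphi f=f\circ\varphi$; it is bounded on $\mathcal{L}_0$ if it maps $\mathcal{L}_0$ into itself and is a bounded operator there. The point spectrum $\sigma_{\mathrm p}(A)$ is the set of eigenvalues of $A$. *)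

theory Defs
  imports "HOL-Analysis.Analysis"
begin

text \<open>
  The vertex set of the tree is the whole type \<open>'v\<close>, and the tree itself is given by its adjacency
  relation. Complex functions on the tree are thus plain functions of type \<open>'v \<Rightarrow> complex\<close>.
\<close>

definition is_path :: "('v \<Rightarrow> 'v \<Rightarrow> bool) \<Rightarrow> 'v \<Rightarrow> 'v list \<Rightarrow> 'v \<Rightarrow> bool" where
  "is_path adj v xs w \<longleftrightarrow>
     xs \<noteq> [] \<and> hd xs = v \<and> last xs = w \<and> distinct xs \<and> successively adj xs"

definition is_cycle :: "('v \<Rightarrow> 'v \<Rightarrow> bool) \<Rightarrow> 'v list \<Rightarrow> bool" where
  "is_cycle adj xs \<longleftrightarrow>
     length xs \<ge> 3 \<and> distinct xs \<and> successively adj xs \<and> adj (last xs) (hd xs)"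

locale rooted_tree =
  fixes adj :: "'v \<Rightarrow> 'v \<Rightarrow> bool" and r :: 'v
  assumes adj_irrefl: "\<not> adj v v"
    and adj_sym: "adj v w \<Longrightarrow> adj w v"
    and connected: "\<exists>xs. is_path adj v xs w"
    and no_cycle: "\<not> is_cycle adj xs"
    and infinite_vertices: "infinite (UNIV :: 'v set)"
    and locally_finite: "finite {w. adj v w}"
    and degree_gt_1: "v \<noteq> r \<Longrightarrow> card {w. adj v w} > 1"

definition tree_path :: "('v \<Rightarrow> 'v \<Rightarrow> bool) \<Rightarrow> 'v \<Rightarrow> 'v \<Rightarrow> 'v list" where
  "tree_path adj v w = (THE xs. is_path adj v xs w)"

text \<open>A path is recorded by its list of vertices, which is one longer than its number of edges.\<close>

definition tree_dist :: "('v \<Rightarrow> 'v \<Rightarrow> bool) \<Rightarrow> 'v \<Rightarrow> 'v \<Rightarrow> nat" where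
  "tree_dist adj v w = length (tree_path adj v w) - 1"

definition level :: "('v \<Rightarrow> 'v \<Rightarrow> bool) \<Rightarrow> 'v \<Rightarrow> 'v \<Rightarrow> nat" where
  "level adj r v = tree_dist adj r v"

text \<open>Only meaningful for \<open>v \<noteq> r\<close>; the root has no parent.\<close>

definition parent :: "('v \<Rightarrow> 'v \<Rightarrow> bool) \<Rightarrow> 'v \<Rightarrow> 'v \<Rightarrow> 'v" where
  "parent adj r v = (THE u. adj v u \<and> u \<in> set (tree_path adj r v))"

definition lip_space :: "('v \<Rightarrow> 'v \<Rightarrow> bool) \<Rightarrow> 'v \<Rightarrow> ('v \<Rightarrow> complex) set" where
  "lip_space adj r =
     {f. bdd_above ((\<lambda>v. cmod (f v - f (parent adj r v))) ` (UNIV - {r}))}"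

definition lip_norm :: "('v \<Rightarrow> 'v \<Rightarrow> bool) \<Rightarrow> 'v \<Rightarrow> ('v \<Rightarrow> complex) \<Rightarrow> real" where
  "lip_norm adj r f =
     max (cmod (f r)) (SUP v\<in>UNIV - {r}. cmod (f v - f (parent adj r v)))"

text \<open>
  The filter below expresses \<open>|v| \<rightarrow> \<infinity>\<close>: its eventual properties are those that hold at all
  vertices of sufficiently large level, so the value at the root plays no role.
\<close>

definition little_lip_space :: "('v \<Rightarrow> 'v \<Rightarrow> bool) \<Rightarrow> 'v \<Rightarrow> ('v \<Rightarrow> complex) set" where
  "little_lip_space adj r =
     {f \<in> lip_space adj r.
        ((\<lambda>v. cmod (f v - f (parent adj r v))) \<longlongrightarrow> 0)
          (filtercomap (level adj r) at_top)}"

definition lip_quotients :: "('v \<Rightarrow> 'v \<Rightarrow> bool) \<Rightarrow> ('v \<Rightarrow> 'v) \<Rightarrow> real set" where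
  "lip_quotients adj \<phi> =
     {real (tree_dist adj (\<phi> v) (\<phi> w)) / real (tree_dist adj v w) | v w. v \<noteq> w}"

definition is_lipschitz :: "('v \<Rightarrow> 'v \<Rightarrow> bool) \<Rightarrow> ('v \<Rightarrow> 'v) \<Rightarrow> bool" where
  "is_lipschitz adj \<phi> \<longleftrightarrow> bdd_above (lip_quotients adj \<phi>)"

definition lip_number :: "('v \<Rightarrow> 'v \<Rightarrow> bool) \<Rightarrow> ('v \<Rightarrow> 'v) \<Rightarrow> real" where
  "lip_number adj \<phi> = Sup (lip_quotients adj \<phi>)"

definition comp_op :: "('v \<Rightarrow> 'v) \<Rightarrow> ('v \<Rightarrow> complex) \<Rightarrow> ('v \<Rightarrow> complex)" where
  "comp_op \<phi> f = f \<circ> \<phi>"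

text \<open>
  Operators on a space \<open>X\<close> of complex functions with norm \<open>N\<close>; only their restriction to \<open>X\<close> matters.
\<close>

definition bounded_operator_on ::
    "('v \<Rightarrow> complex) set \<Rightarrow> (('v \<Rightarrow> complex) \<Rightarrow> real) \<Rightarrow>
     (('v \<Rightarrow> complex) \<Rightarrow> ('v \<Rightarrow> complex)) \<Rightarrow> bool" where
  "bounded_operator_on X N A \<longleftrightarrow>
     (\<forall>f\<in>X. A f \<in> X) \<and>
     (\<forall>f\<in>X. \<forall>g\<in>X. \<forall>a b. A (\<lambda>v. a * f v + b * g v) = (\<lambda>v. a * A f v + b * A g v)) \<and>
     (\<exists>C. \<forall>f\<in>X. N (A f) \<le> C * N f)"

definition point_spectrum_on ::
    "('v \<Rightarrow> complex) set \<Rightarrow> (('v \<Rightarrow> complex) \<Rightarrow> ('v \<Rightarrow> complex)) \<Rightarrow> complex set" where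
  "point_spectrum_on X A = {\<mu>. \<exists>f\<in>X. f \<noteq> (\<lambda>v. 0) \<and> A f = (\<lambda>v. \<mu> * f v)}"

end

theory Submission
  imports Defs
begin

text \<open>
  Let \<open>f\<close> be an eigenfunction for \<open>\<mu>\<close> with \<open>f v \<noteq> 0\<close>. Then \<open>f (\<phi>\<^sup>n v) = \<mu>\<^sup>n f v\<close>.
  Consecutive points of the orbit of \<open>v\<close> satisfy
  \<open>d(\<phi>\<^sup>k v, \<phi>\<^sup>k\<^sup>+\<^sup>1 v) \<le> \<lambda>\<^sup>k d(v, \<phi> v)\<close>, so a function with Lipschitz
  constant \<open>L\<close> along the edges satisfies
  \<open>|f (\<phi>\<^sup>n v)| \<le> |f v| + n \<lambda>\<^sup>n L d(v, \<phi> v)\<close>; here \<open>\<lambda> \<ge> 1\<close> because a nonconstant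
  map separates the ends of some edge. If \<open>|\<mu>| > \<lambda>\<close>, this contradicts
  \<open>|f (\<phi>\<^sup>n v)| = |\<mu>|\<^sup>n |f v|\<close> for large \<open>n\<close>.
\<close>

section \<open>Paths and their uniqueness\<close>

lemma is_path_Cons:
  "is_path adj v (u # xs) w \<longleftrightarrow>
     u = v \<and> (if xs = [] then v = w
              else v \<notin> set xs \<and> adj v (hd xs) \<and> is_path adj (hd xs) xs w)"
  by (cases xs) (auto simp: is_path_def)

lemma is_path_snoc:
  "is_path adj u xs v \<Longrightarrow> adj v w \<Longrightarrow> w \<notin> set xs \<Longrightarrow> is_path adj u (xs @ [w]) w"
  by (auto simp: is_path_def successively_append_iff)

lemma is_path_prefix: "is_path adj u (xs @ v # ys) w \<Longrightarrow> is_path adj u (xs @ [v]) v"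
  using successively_append_iff[of adj "xs @ [v]" ys] by (cases xs) (auto simp: is_path_def)

lemma is_path_same_ends: "is_path adj v xs v \<Longrightarrow> xs = [v]"
  by (cases xs) (auto simp: is_path_def split: if_splits)

context rooted_tree
begin

text \<open>
  If two paths leave \<open>v\<close> along different edges, follow the first one until it meets the second one
  and return along the second one: this is a cycle.
\<close>

lemma is_path_same_first_step:
  assumes xs: "is_path adj v (v # xs) w" and ys: "is_path adj v (v # ys) w"
    and ne: "xs \<noteq> []" "ys \<noteq> []"
  shows "hd xs = hd ys"
proof (rule ccontr)
  assume neq: "hd xs \<noteq> hd ys"
  \<comment> \<open>Both paths end in \<open>w\<close>, so the two tails are sure to meet.\<close>
  have "last xs \<in> set ys"
    using xs ys ne by (simp add: is_path_def) (metis last_in_set)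
  then have "\<exists>x\<in>set xs. x \<in> set ys" using ne by (meson last_in_set)
  then obtain a p b where a: "xs = a @ p # b" "p \<in> set ys" "\<forall>x\<in>set a. x \<notin> set ys"
    using split_list_first_prop[of xs "\<lambda>x. x \<in> set ys"] by blast
  obtain c d where c: "ys = c @ p # d" using a(2) by (meson split_list)
  have sx: "successively adj (v # a @ [p])" "distinct (v # a @ [p])"
    using is_path_prefix[of adj v "v # a" p b w] xs by (auto simp: is_path_def a)
  have sy: "successively adj (v # c @ [p])" "distinct (v # c @ [p])"
    using is_path_prefix[of adj v "v # c" p d w] ys by (auto simp: is_path_def c)
  have "successively adj (rev (v # c @ [p]))"
    unfolding successively_rev using sy(1) by (rule successively_mono) (auto intro: adj_sym)
  then have sr: "successively adj (p # rev c @ [v])" by simp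
  have "is_cycle adj (v # a @ p # rev c)"
    unfolding is_cycle_def
  proof (intro conjI)
    \<comment> \<open>If \<open>a\<close> and \<open>c\<close> were both empty, both paths would
      start with the edge to \<open>p\<close>, against \<open>neq\<close>; so at least three
      vertices remain.\<close>
    show "3 \<le> length (v # a @ p # rev c)" using neq a(1) c by (cases a; cases c) auto
    show "distinct (v # a @ p # rev c)" using sx(2) sy(2) a(3) c by auto
    have "successively adj ((p # rev c) @ [v])" using sr by simp
    then have sp: "successively adj (p # rev c)" and l: "adj (last (p # rev c)) v"
      unfolding successively_append_iff by simp_all
    show "adj (last (v # a @ p # rev c)) (hd (v # a @ p # rev c))" using l by simp
    have "successively adj ((v # a) @ [p])" using sx(1) by simp
    then show "successively adj (v # a @ p # rev c)"
      using sp successively_append_iff[of adj "v # a" "p # rev c"]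
        successively_append_iff[of adj "v # a" "[p]"] by simp
  qed
  then show False using no_cycle by blast
qed

text \<open>Peel off the common first step and induct on the rest. The case \<open>v = w\<close>
  stands apart: a path from a vertex to itself is a singleton and has no first step.\<close>

lemma is_path_unique: "is_path adj v xs w \<Longrightarrow> is_path adj v ys w \<Longrightarrow> xs = ys"
proof (induction xs arbitrary: v ys)
  case Nil
  then show ?case by (simp add: is_path_def)
next
  case (Cons x xs)
  obtain zs where ys: "ys = v # zs" using Cons.prems(2) by (cases ys) (auto simp: is_path_def)
  have x: "x = v" using Cons.prems(1) by (simp add: is_path_def)
  show ?case
  proof (cases "v = w")
    case True
    then show ?thesis using Cons.prems is_path_same_ends by metis
  next
    case False
    then have ne: "xs \<noteq> []" "zs \<noteq> []" using Cons.prems ys by (auto simp: is_path_def)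
    then have "hd xs = hd zs"
      using Cons.prems ys x is_path_same_first_step by blast
    then show ?thesis using Cons.IH[of "hd xs" zs] Cons.prems ne ys x
      by (simp add: is_path_Cons)
  qed
qed

section \<open>Tree paths and parents\<close>

lemma tree_path_eq: "is_path adj v xs w \<Longrightarrow> tree_path adj v w = xs"
  unfolding tree_path_def by (rule the_equality) (auto intro: is_path_unique)

lemma is_path_tree_path: "is_path adj v (tree_path adj v w) w"
  using connected tree_path_eq by metis

text \<open>Cutting the path at \<open>u\<close> and appending \<open>v\<close> gives another path
  from \<open>r\<close> to \<open>v\<close>, which by uniqueness is the whole path. So a neighbour
  of \<open>v\<close> on it can only be the next-to-last vertex.\<close>

lemma tree_path_via_neighbour:
  assumes "adj v u" "u \<in> set (tree_path adj r v)"
  obtains xs where "tree_path adj r v = xs @ [u, v]"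
proof -
  obtain xs ys where P: "tree_path adj r v = xs @ u # ys" using assms(2) by (meson split_list)
  have p: "is_path adj r (xs @ u # ys) v" using is_path_tree_path[of r v] P by simp
  \<comment> \<open>As the path ends in \<open>v\<close>, this puts \<open>v\<close> behind
    \<open>u\<close>; distinctness then keeps \<open>v\<close> off the initial part up to
    \<open>u\<close>.\<close>
  have "u \<noteq> v" using assms(1) adj_irrefl by auto
  then have "v \<in> set ys" using p by (cases ys rule: rev_cases) (auto simp: is_path_def)
  then have "v \<notin> set (xs @ [u])" using p by (auto simp: is_path_def)
  then have "is_path adj r ((xs @ [u]) @ [v]) v"
    using is_path_prefix[OF p] adj_sym[OF assms(1)] by (rule is_path_snoc[rotated 2])
  then have "tree_path adj r v = xs @ [u, v]" using tree_path_eq by simp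
  then show thesis by (rule that)
qed

lemma parent_eq:
  assumes "adj v u" "u \<in> set (tree_path adj r v)"
  shows "parent adj r v = u"
  unfolding parent_def
proof (rule the_equality)
  show "adj v u \<and> u \<in> set (tree_path adj r v)" using assms by simp
  fix w assume w: "adj v w \<and> w \<in> set (tree_path adj r v)"
  obtain xs where "tree_path adj r v = xs @ [u, v]"
    using assms by (rule tree_path_via_neighbour)
  moreover obtain ys where "tree_path adj r v = ys @ [w, v]"
    using w tree_path_via_neighbour by blast
  ultimately show "w = u" by simp
qed

lemma root_not_below_neighbour:
  assumes "adj v u" "u \<in> set (tree_path adj r v)"
  shows "v \<noteq> r"
proof
  assume "v = r"
  moreover obtain xs where "tree_path adj r v = xs @ [u, v]"
    using assms by (rule tree_path_via_neighbour)
  ultimately show False using is_path_same_ends is_path_tree_path[of r v] by fastforce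
qed

text \<open>If \<open>w\<close> is not on the path from \<open>r\<close> to \<open>v\<close>,
  appending it yields the path to \<open>w\<close>, so \<open>v\<close> is the parent of
  \<open>w\<close>; otherwise \<open>w\<close> is the parent of \<open>v\<close>. Thus a bound on
  differences to the parent reaches every edge.\<close>

lemma adj_cases_parent:
  assumes "adj v w"
  obtains "v \<noteq> r" "parent adj r v = w" | "w \<noteq> r" "parent adj r w = v"
proof (cases "w \<in> set (tree_path adj r v)")
  case True
  show thesis
    using that(1) root_not_below_neighbour[OF assms True] parent_eq[OF assms True] .
next
  case False
  then have "tree_path adj r w = tree_path adj r v @ [w]"
    by (intro tree_path_eq is_path_snoc[OF is_path_tree_path assms])
  moreover have "v \<in> set (tree_path adj r v)"
    using is_path_tree_path[of r v] unfolding is_path_def by (metis last_in_set)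
  ultimately have v: "v \<in> set (tree_path adj r w)" by simp
  show thesis
    using that(2) root_not_below_neighbour[OF adj_sym[OF assms] v]
      parent_eq[OF adj_sym[OF assms] v] .
qed

section \<open>Lipschitz bounds and tree distance\<close>

lemma lip_space_edge_bound:
  assumes "f \<in> lip_space adj r"
  obtains L where "L \<ge> 0" "\<And>v w. adj v w \<Longrightarrow> cmod (f v - f w) \<le> L"
proof -
  obtain B where B: "v \<noteq> r \<Longrightarrow> cmod (f v - f (parent adj r v)) \<le> B" for v
    using assms by (auto simp: lip_space_def bdd_above_def)
  \<comment> \<open>The maximum makes the bound nonnegative without having to exhibit a vertex other
    than \<open>r\<close>.\<close>
  have "cmod (f v - f w) \<le> max B 0" if "adj v w" for v w
    using that
  proof (cases rule: adj_cases_parent)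
    case 1
    then show ?thesis using B[of v] by auto
  next
    case 2
    then show ?thesis using B[of w] by (auto simp: norm_minus_commute)
  qed
  then show thesis using that[of "max B 0"] by auto
qed

text \<open>The edge bounds add up along the path by the triangle inequality.\<close>

lemma dist_le_tree_dist:
  fixes f :: "'v \<Rightarrow> 'a :: metric_space"
  assumes "\<And>v w. adj v w \<Longrightarrow> dist (f v) (f w) \<le> L"
  shows "dist (f v) (f w) \<le> L * real (tree_dist adj v w)"
proof -
  have "dist (f v) (f w) \<le> L * real (length xs - 1)" if "is_path adj v xs w" for v w xs
    using that
  proof (induction xs arbitrary: v)
    case Nil
    then show ?case by (simp add: is_path_def)
  next
    case (Cons x xs)
    show ?case
    proof (cases "xs = []")
      case True
      then show ?thesis using Cons.prems by (simp add: is_path_Cons)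
    next
      case False
      then have "dist (f (hd xs)) (f w) \<le> L * real (length xs - 1)" "dist (f v) (f (hd xs)) \<le> L"
        using Cons assms by (auto simp: is_path_Cons)
      then have "dist (f v) (f w) \<le> L + L * real (length xs - 1)"
        by (smt (verit) dist_triangle)
      \<comment> \<open>Since \<open>xs\<close> is nonempty, the truncated subtraction is exact: one
        more vertex is one more edge.\<close>
      also have "\<dots> = L * real (length (x # xs) - 1)"
        using False by (cases xs) (auto simp: algebra_simps)
      finally show ?thesis .
    qed
  qed
  then show ?thesis using is_path_tree_path by (simp add: tree_dist_def)
qed

lemma tree_dist_pos: "v \<noteq> w \<Longrightarrow> tree_dist adj v w \<ge> 1"
  using is_path_tree_path[of v w] unfolding tree_dist_def
  by (cases "tree_path adj v w"; cases "tl (tree_path adj v w)") (auto simp: is_path_def)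

lemma tree_dist_self: "tree_dist adj v v = 0"
  using is_path_same_ends[OF is_path_tree_path[of v v]] by (simp add: tree_dist_def)

lemma tree_dist_adj: "adj v w \<Longrightarrow> tree_dist adj v w = 1"
  using tree_path_eq[of v "[v, w]" w] adj_irrefl[of v]
  by (cases "v = w") (auto simp: tree_dist_def is_path_def)

text \<open>Equality propagates along a path. The contrapositive supplies an edge whose ends a
  nonconstant map separates.\<close>

lemma constant_if_constant_on_edges:
  assumes "\<And>v w. adj v w \<Longrightarrow> g v = g w"
  shows "g v = g w"
proof -
  have "g v = g w" if "is_path adj v xs w" for v xs
    using that
  proof (induction xs arbitrary: v)
    case Nil
    then show ?case by (simp add: is_path_def)
  next
    case (Cons x xs)
    then show ?case using assms by (cases "xs = []") (auto simp: is_path_Cons)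
  qed
  then show ?thesis using connected by blast
qed

section \<open>The Lipschitz number and growth along orbits\<close>

lemma tree_dist_le_lip_number:
  assumes "is_lipschitz adj \<phi>"
  shows "real (tree_dist adj (\<phi> v) (\<phi> w)) \<le> lip_number adj \<phi> * real (tree_dist adj v w)"
proof (cases "v = w")
  case True
  then show ?thesis by (simp add: tree_dist_self)
next
  case False
  then have "real (tree_dist adj (\<phi> v) (\<phi> w)) / real (tree_dist adj v w) \<le> lip_number adj \<phi>"
    unfolding lip_number_def
    by (intro cSup_upper assms[unfolded is_lipschitz_def]) (auto simp: lip_quotients_def)
  then show ?thesis using tree_dist_pos[OF False] by (simp add: divide_le_eq)
qed

text \<open>An edge whose ends have distinct images gives a quotient of at least 1, its denominator
  being 1.\<close>

lemma lip_number_ge_1: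
  assumes "\<not> \<phi> constant_on UNIV" "is_lipschitz adj \<phi>"
  shows "lip_number adj \<phi> \<ge> 1"
proof -
  obtain v w where vw: "adj v w" "\<phi> v \<noteq> \<phi> w"
    using assms(1) constant_if_constant_on_edges[of \<phi>] unfolding constant_on_def by blast
  then show ?thesis
    using tree_dist_le_lip_number[OF assms(2), of v w] tree_dist_pos[OF vw(2)]
    by (simp add: tree_dist_adj)
qed

lemma tree_dist_orbit_le:
  assumes "is_lipschitz adj \<phi>" "lip_number adj \<phi> \<ge> 0"
  shows "real (tree_dist adj ((\<phi> ^^ k) v) ((\<phi> ^^ k) w))
           \<le> lip_number adj \<phi> ^ k * real (tree_dist adj v w)"
proof (induction k)
  case 0
  then show ?case by simp
next
  case (Suc k)
  have "real (tree_dist adj ((\<phi> ^^ Suc k) v) ((\<phi> ^^ Suc k) w))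
          \<le> lip_number adj \<phi> * real (tree_dist adj ((\<phi> ^^ k) v) ((\<phi> ^^ k) w))"
    using tree_dist_le_lip_number[OF assms(1)] by simp
  also have "\<dots> \<le> lip_number adj \<phi> * (lip_number adj \<phi> ^ k * real (tree_dist adj v w))"
    using Suc assms(2) by (rule mult_left_mono)
  finally show ?case by (simp add: mult.assoc)
qed

text \<open>The one-step bounds add up to a geometric sum. As the Lipschitz number is at least 1,
  each term is at most its n-th power, so a factor n replaces the sum and the value 1 needs no
  separate case.\<close>

lemma lip_space_orbit_growth:
  assumes "is_lipschitz adj \<phi>" "lip_number adj \<phi> \<ge> 1" "f \<in> lip_space adj r"
  obtains D where "\<And>n. cmod (f ((\<phi> ^^ n) v)) \<le> cmod (f v) + D * (real n * lip_number adj \<phi> ^ n)"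
proof -
  define c where "c = lip_number adj \<phi>"
  obtain L where L: "L \<ge> 0" "\<And>v w. adj v w \<Longrightarrow> cmod (f v - f w) \<le> L"
    using lip_space_edge_bound[OF assms(3)] by blast
  define D where "D = L * real (tree_dist adj v (\<phi> v))"
  have D: "D \<ge> 0" using L by (simp add: D_def)
  have step: "cmod (f ((\<phi> ^^ Suc k) v)) \<le> cmod (f ((\<phi> ^^ k) v)) + D * c ^ k" for k
  proof -
    have "dist (f ((\<phi> ^^ k) v)) (f ((\<phi> ^^ k) (\<phi> v)))
            \<le> L * real (tree_dist adj ((\<phi> ^^ k) v) ((\<phi> ^^ k) (\<phi> v)))"
      by (rule dist_le_tree_dist) (simp add: dist_norm L)
    also have "\<dots> \<le> L * (c ^ k * real (tree_dist adj v (\<phi> v)))"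
      unfolding c_def using assms L by (intro mult_left_mono tree_dist_orbit_le) auto
    \<comment> \<open>Iterating \<open>\<phi>\<close> from \<open>\<phi> v\<close> gives the next
      orbit point of \<open>v\<close>.\<close>
    finally have "dist (f ((\<phi> ^^ k) v)) (f ((\<phi> ^^ Suc k) v)) \<le> D * c ^ k"
      by (simp add: D_def funpow_swap1 mult_ac)
    then show ?thesis
      using norm_triangle_ineq2[of "f ((\<phi> ^^ Suc k) v)" "f ((\<phi> ^^ k) v)"]
      by (simp add: dist_norm norm_minus_commute)
  qed
  have "cmod (f ((\<phi> ^^ n) v)) \<le> cmod (f v) + D * (real n * c ^ n)" for n
  proof (induction n)
    case 0
    then show ?case by simp
  next
    case (Suc n)
    have "real n * c ^ n + c ^ n \<le> real (Suc n) * c ^ Suc n"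
      using assms(2) power_increasing[of n "Suc n" c]
        mult_left_mono[of "c ^ n" "c ^ Suc n" "real (Suc n)"]
      by (simp add: c_def algebra_simps)
    then have "D * (real n * c ^ n + c ^ n) \<le> D * (real (Suc n) * c ^ Suc n)"
      using D by (rule mult_left_mono)
    then show ?case using Suc step[of n] by (simp add: distrib_left)
  qed
  then show thesis using that unfolding c_def by blast
qed

lemma eigenvalue_norm_le_lip_number:
  assumes "is_lipschitz adj \<phi>" "lip_number adj \<phi> \<ge> 1" "f \<in> lip_space adj r"
    and "f \<noteq> (\<lambda>v. 0)" "comp_op \<phi> f = (\<lambda>v. \<mu> * f v)"
  shows "cmod \<mu> \<le> lip_number adj \<phi>"
proof (rule ccontr)
  define c where "c = lip_number adj \<phi>"
  define m where "m = cmod \<mu>"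
  assume "\<not> cmod \<mu> \<le> lip_number adj \<phi>"
  then have cm: "1 \<le> c" "c < m" using assms(2) by (auto simp: c_def m_def)
  obtain v where v: "f v \<noteq> 0" using assms(4) by auto
  have "f (\<phi> u) = \<mu> * f u" for u using fun_cong[OF assms(5), of u] by (simp add: comp_op_def)
  then have orbit: "f ((\<phi> ^^ n) v) = \<mu> ^ n * f v" for n by (induction n) auto
  obtain D where D: "cmod (f ((\<phi> ^^ n) v)) \<le> cmod (f v) + D * (real n * c ^ n)" for n
    using lip_space_orbit_growth[OF assms(1-3), of v] unfolding c_def by metis
  \<comment> \<open>This is the growth bound divided by \<open>m ^ n\<close>: the left side no
    longer depends on n, while the right side tends to 0 because \<open>1 / m\<close> and
    \<open>c / m\<close> lie strictly between 0 and 1.\<close>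
  have "cmod (f v) \<le> cmod (f v) * (1 / m) ^ n + D * (real n * (c / m) ^ n)" for n
  proof -
    have "m ^ n * cmod (f v) \<le> cmod (f v) + D * (real n * c ^ n)"
      using D[of n] by (simp add: orbit m_def norm_mult norm_power)
    then show ?thesis using cm by (simp add: field_simps)
  qed
  moreover have "(\<lambda>n. cmod (f v) * (1 / m) ^ n + D * (real n * (c / m) ^ n))
      \<longlonglongrightarrow> cmod (f v) * 0 + D * 0"
    using cm by (intro tendsto_intros LIMSEQ_power_zero powser_times_n_limit_0) auto
  ultimately have "cmod (f v) \<le> cmod (f v) * 0 + D * 0"
    by (intro LIMSEQ_le_const) auto
  then show False using v by simp
qed

end

theorem theorem4p2:
  fixes adj :: "'v \<Rightarrow> 'v \<Rightarrow> bool" and r :: 'v and \<phi> :: "'v \<Rightarrow> 'v"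
  assumes "rooted_tree adj r"
    and "\<not> \<phi> constant_on UNIV"
    and "is_lipschitz adj \<phi>"
    and "bounded_operator_on (little_lip_space adj r) (lip_norm adj r) (comp_op \<phi>)"
  shows "point_spectrum_on (little_lip_space adj r) (comp_op \<phi>) \<subseteq> cball 0 (lip_number adj \<phi>)"
proof
  interpret rooted_tree adj r by fact
  fix \<mu> assume "\<mu> \<in> point_spectrum_on (little_lip_space adj r) (comp_op \<phi>)"
  then obtain f where "f \<in> lip_space adj r" "f \<noteq> (\<lambda>v. 0)" "comp_op \<phi> f = (\<lambda>v. \<mu> * f v)"
    by (auto simp: point_spectrum_on_def little_lip_space_def)
  then show "\<mu> \<in> cball 0 (lip_number adj \<phi>)"
    using eigenvalue_norm_le_lip_number lip_number_ge_1 assms(2,3) by simp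
qed

end
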